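(* Let $k\ge1$, let $m_1,\dots,m_N$ ($N=M(k)$) be all monotonic Boolean functions $\mathbb{B}^k\to\mathbb{B}$, and write $\mathbf{m}(\mathbf{x})=(m_1(\mathbf{x}),\dots,m_N(\mathbf{x}))\in\mathbb{B}^N$. For a coefficient vector $c=(c_0,a_i,b_l,\alpha_{ij},\beta_{il},\gamma_{ll'})$ let $$H_c(\mathbf{x},\mathbf{z})=c_0+\sum_{i=1}^k a_ix_i+\sum_{l=1}^N b_lz_l+\sum_{1\le i<j\le k}\alpha_{ij}x_ix_j+\sum_{i,l}\beta_{il}x_iz_l+\sum_{1\le l<l'\le N}\gamma_{ll'}z_lz_{l'},\qquad \mathbf{x}\in\mathbb{B}^k,\ \mathbf{z}\in\mathbb{B}^N.$$ Given $f:\mathbb{B}^k\to\mathbb{R}$, consider the linear program in the variables $c$ and $(t_{\mathbf{x}})_{\mathbf{x}\in\mathbb{B}^k}$: minimize $\sum_{\mathbf{x}}t_{\mathbf{x}}$ subject to (i) $t_{\mathbf{x}}\ge f(\mathbf{x})-H_c(\mathbf{x},\mathbf{m}(\mathbf{x}))$ and $t_{\mathbf{x}}\ge H_c(\mathbf{x},\mathbf{m}(\mathbf{x}))-f(\mathbf{x})$ for all $\mathbf{x}$; (ii) $\alpha_{ij}\le0$, $\beta_{il}\le0$, $\gamma_{ll'}\le0$ for all indices; (iii) $H_c(\mathbf{x},\mathbf{m}(\mathbf{x}))\le H_c(\mathbf{x},\mathbf{z})$ for all $\mathbf{x}\in\mathbb{B}^k$ and all $\mathbf{z}\in\mathbb{B}^N$.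 If $f\in\mathcal{F}^k_2$, then this linear program is feasible with optimal value $0$, and for every optimal solution the function $H_c$ lies in $\mathcal{F}^2$ and satisfies $f(\mathbf{x})=\min_{\mathbf{z}\in\mathbb{B}^N}H_c(\mathbf{x},\mathbf{z})$ for all $\mathbf{x}\in\mathbb{B}^k$.
   Context: $\mathbb{B}=\{0,1\}$. Pseudo-Boolean functions $\mathbb{B}^n\to\mathbb{R}$ are uniquely multilinear polynomials; order = degree. Submodular: $f(X)+f(Y)\ge f(X\vee Y)+f(X\wedge Y)$. $\mathcal{F}^2$: submodular pseudo-Boolean functions of order $\le2$ (degree-$\le2$ multilinear polynomials with non-positive bilinear coefficients). $\mathcal{F}^k_2$: the set of submodular $f:\mathbb{B}^k\to\mathbb{R}$ for which there exist $m$ and $h\in\mathcal{F}^2$ on $\mathbb{B}^k\times\mathbb{B}^m$ with $f(\mathbf{x})=\min_{\mathbf{z}}h(\mathbf{x},\mathbf{z})$ for all $\mathbf{x}$. A monotonic Boolean function is $\phi:\mathbb{B}^k\to\mathbb{B}$ with $\phi(\mathbf{y})\le\phi(\mathbf{x})$ whenever $\mathbf{y}\le\mathbf{x}$ componentwise; $M(k)$ (Dedekind number) is their number. The paper expresses constraint (iii) (that $\mathbf{m}(\mathbf{x})$ is a minimizing labeling of the auxiliary variables) through a max-flow linear program; here it is written as the equivalent finite family of linear inequalities. *)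

theory Defs
  imports Complex_Main "HOL-Library.FuncSet"
begin

text \<open>
  For a finite index set \<open>I\<close>, the cube \<open>cube I\<close> is the set of 0/1-vectors indexed by \<open>I\<close>
  (extensional, i.e. \<open>undefined\<close> off \<open>I\<close>); the real values let vectors be plugged into
  polynomials directly. Because \<open>sup\<close>, \<open>inf\<close> and \<open>\<le>\<close> on functions are pointwise and
  two cube elements agree off \<open>I\<close>, they are the componentwise operations and order of the cube.
  A pseudo-Boolean function is an \<open>f :: ('i \<Rightarrow> real) \<Rightarrow> real\<close> of which only the values on
  \<open>cube I\<close> matter.
\<close>

definition cube :: "'i set \<Rightarrow> ('i \<Rightarrow> real) set"
  where "cube I = I \<rightarrow>\<^sub>E {0, 1}"

definition submodular :: "'i set \<Rightarrow> (('i \<Rightarrow> real) \<Rightarrow> real) \<Rightarrow> bool"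
  where "submodular I f \<longleftrightarrow>
    (\<forall>x\<in>cube I. \<forall>y\<in>cube I. f x + f y \<ge> f (sup x y) + f (inf x y))"

definition mlpoly :: "'i set \<Rightarrow> ('i set \<Rightarrow> real) \<Rightarrow> ('i \<Rightarrow> real) \<Rightarrow> real"
  where "mlpoly I p x = (\<Sum>S\<in>Pow I. p S * (\<Prod>i\<in>S. x i))"

text \<open>The representing multilinear polynomial is unique (\<open>mlpoly_unique\<close> below), so the
  existential quantifier speaks about the degree of \<^emph>\<open>the\<close> polynomial of \<open>f\<close>.\<close>

definition order_at_most :: "'i set \<Rightarrow> nat \<Rightarrow> (('i \<Rightarrow> real) \<Rightarrow> real) \<Rightarrow> bool"
  where "order_at_most I d f \<longleftrightarrow>
    (\<exists>p. (\<forall>x\<in>cube I. f x = mlpoly I p x) \<and> (\<forall>S\<subseteq>I. p S \<noteq> 0 \<longrightarrow> card S \<le> d))"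

lemma mlpoly_unique:
  assumes "finite I" and eq: "\<And>x. x \<in> cube I \<Longrightarrow> mlpoly I p x = mlpoly I q x" and "S \<subseteq> I"
  shows "p S = q S"
proof -
  have ev: "mlpoly I r (\<lambda>i\<in>I. if i \<in> S then 1 else 0) = (\<Sum>T\<in>Pow S. r T)"
    if "S \<subseteq> I" for r S
  proof -
    have "(\<Prod>i\<in>T. (\<lambda>i\<in>I. if i \<in> S then 1 else (0::real)) i) = (if T \<subseteq> S then 1 else 0)"
      if "T \<subseteq> I" for T
    proof (cases "T \<subseteq> S")
      case True
      then show ?thesis using that by (auto intro!: prod.neutral)
    next
      case False
      then obtain j where j: "j \<in> T" "j \<notin> S" by blast
      have "finite T" using that \<open>finite I\<close> by (rule finite_subset)
      with j that have "(\<Prod>i\<in>T. (\<lambda>i\<in>I. if i \<in> S then 1 else (0::real)) i) = 0"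
        by (intro prod_zero) (auto intro!: bexI[of _ j])
      with False show ?thesis by simp
    qed
    then have "mlpoly I r (\<lambda>i\<in>I. if i \<in> S then 1 else 0)
        = (\<Sum>T\<in>Pow I. if T \<subseteq> S then r T else 0)"
      unfolding mlpoly_def by (intro sum.cong) auto
    also have "\<dots> = (\<Sum>T\<in>Pow S. r T)"
      using \<open>finite I\<close> \<open>S \<subseteq> I\<close> by (intro sum.mono_neutral_cong_right) auto
    finally show ?thesis .
  qed
  have "finite S" using assms finite_subset by blast
  then show ?thesis using \<open>S \<subseteq> I\<close>
  proof (induction S rule: finite_psubset_induct)
    case (psubset S)
    have "(\<Sum>T\<in>Pow S. p T) = (\<Sum>T\<in>Pow S. q T)"
      using eq[of "\<lambda>i\<in>I. if i \<in> S then 1 else 0"] ev[OF psubset.prems]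
      by (simp add: cube_def)
    moreover have "(\<Sum>T\<in>Pow S. r T) = r S + (\<Sum>T\<in>Pow S - {S}. r T)" for r :: "_ \<Rightarrow> real"
      using psubset.hyps by (intro sum.remove) auto
    moreover have "(\<Sum>T\<in>Pow S - {S}. p T) = (\<Sum>T\<in>Pow S - {S}. q T)"
      using psubset by (intro sum.cong) auto
    ultimately show ?case by simp
  qed
qed

definition F2 :: "'i set \<Rightarrow> (('i \<Rightarrow> real) \<Rightarrow> real) set"
  where "F2 I = {f. submodular I f \<and> order_at_most I 2 f}"

text \<open>
  \<open>B\<^sup>k \<times> B\<^sup>n\<close> is the cube over the disjoint sum \<open>{1..k} <+> {1..n}\<close>; the pair of \<open>x\<close> and \<open>z\<close>
  is the vector \<open>case_sum x z\<close>.
\<close>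

definition F2_joint :: "nat \<Rightarrow> nat \<Rightarrow> ((nat \<Rightarrow> real) \<Rightarrow> (nat \<Rightarrow> real) \<Rightarrow> real) set"
  where "F2_joint k n = {h. (\<lambda>w. h (w \<circ> Inl) (w \<circ> Inr)) \<in> F2 ({1..k} <+> {1..n})}"

definition Fk2 :: "nat \<Rightarrow> ((nat \<Rightarrow> real) \<Rightarrow> real) set"
  where "Fk2 k = {f. submodular {1..k} f \<and>
    (\<exists>n. \<exists>h\<in>F2_joint k n. \<forall>x\<in>cube {1..k}. f x = Min (h x ` cube {1..n}))}"

definition monotonic_bool :: "nat \<Rightarrow> ((nat \<Rightarrow> real) \<Rightarrow> real) set"
  where "monotonic_bool k = {\<phi> \<in> cube {1..k} \<rightarrow>\<^sub>E {0, 1}. mono_on (cube {1..k}) \<phi>}"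

definition dedekind :: "nat \<Rightarrow> nat"
  where "dedekind k = card (monotonic_bool k)"

text \<open>Only coefficients with indices in the ranges of the sums below are relevant.\<close>

record coeffs =
  cf_0 :: real
  cf_a :: "nat \<Rightarrow> real"
  cf_b :: "nat \<Rightarrow> real"
  cf_alpha :: "nat \<Rightarrow> nat \<Rightarrow> real"
  cf_beta :: "nat \<Rightarrow> nat \<Rightarrow> real"
  cf_gamma :: "nat \<Rightarrow> nat \<Rightarrow> real"

definition H :: "nat \<Rightarrow> nat \<Rightarrow> coeffs \<Rightarrow> (nat \<Rightarrow> real) \<Rightarrow> (nat \<Rightarrow> real) \<Rightarrow> real"
  where "H k N c x z =
    cf_0 c + (\<Sum>i=1..k. cf_a c i * x i) + (\<Sum>l=1..N. cf_b c l * z l)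
    + (\<Sum>i=1..k. \<Sum>j=i+1..k. cf_alpha c i j * x i * x j)
    + (\<Sum>i=1..k. \<Sum>l=1..N. cf_beta c i l * x i * z l)
    + (\<Sum>l=1..N. \<Sum>l'=l+1..N. cf_gamma c l l' * z l * z l')"

definition mvec :: "nat \<Rightarrow> (nat \<Rightarrow> (nat \<Rightarrow> real) \<Rightarrow> real) \<Rightarrow> (nat \<Rightarrow> real) \<Rightarrow> (nat \<Rightarrow> real)"
  where "mvec N m x = (\<lambda>l\<in>{1..N}. m l x)"

definition lp_feasible ::
  "nat \<Rightarrow> nat \<Rightarrow> (nat \<Rightarrow> (nat \<Rightarrow> real) \<Rightarrow> real) \<Rightarrow> ((nat \<Rightarrow> real) \<Rightarrow> real)
    \<Rightarrow> coeffs \<times> ((nat \<Rightarrow> real) \<Rightarrow> real) \<Rightarrow> bool"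
  where "lp_feasible k N m f = (\<lambda>(c, t).
    (\<forall>x\<in>cube {1..k}. t x \<ge> f x - H k N c x (mvec N m x) \<and>
                     t x \<ge> H k N c x (mvec N m x) - f x) \<and>
    (\<forall>i j. 1 \<le> i \<and> i < j \<and> j \<le> k \<longrightarrow> cf_alpha c i j \<le> 0) \<and>
    (\<forall>i\<in>{1..k}. \<forall>l\<in>{1..N}. cf_beta c i l \<le> 0) \<and>
    (\<forall>l l'. 1 \<le> l \<and> l < l' \<and> l' \<le> N \<longrightarrow> cf_gamma c l l' \<le> 0) \<and>
    (\<forall>x\<in>cube {1..k}. \<forall>z\<in>cube {1..N}. H k N c x (mvec N m x) \<le> H k N c x z))"

definition lp_objective :: "nat \<Rightarrow> coeffs \<times> ((nat \<Rightarrow> real) \<Rightarrow> real) \<Rightarrow> real"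
  where "lp_objective k = (\<lambda>(c, t). \<Sum>x\<in>cube {1..k}. t x)"

abbreviation lp_optimal ::
  "nat \<Rightarrow> nat \<Rightarrow> (nat \<Rightarrow> (nat \<Rightarrow> real) \<Rightarrow> real) \<Rightarrow> ((nat \<Rightarrow> real) \<Rightarrow> real)
    \<Rightarrow> coeffs \<times> ((nat \<Rightarrow> real) \<Rightarrow> real) \<Rightarrow> bool"
  where "lp_optimal k N m f \<equiv> is_arg_min (lp_objective k) (lp_feasible k N m f)"

end

theory Submission
  imports Defs
begin

text \<open>
  Let \<open>h\<close> be a quadratic submodular representation of \<open>f\<close> with auxiliary variables \<open>z\<^sub>1, \<dots>, z\<^sub>n\<close>.
  The smallest minimiser \<open>z\<^sup>*(x)\<close> of \<open>h(x, \<cdot>)\<close> is monotone in \<open>x\<close> by submodularity, so each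
  coordinate \<open>z\<^sup>*\<^sub>j\<close> is one of the monotonic functions, say \<open>m\<^bsub>l(j)\<^esub>\<close>. Identifying auxiliary variables
  with equal \<open>l(j)\<close>, that is, substituting \<open>z\<^sub>j := z'\<^bsub>l(j)\<^esub>\<close>, preserves membership in \<open>F2\<close> and gives a
  feasible point of the linear program with \<open>t = 0\<close>. Conversely \<open>t = 0\<close> in every optimal solution,
  so that the constraints say precisely that \<open>H\<close> represents \<open>f\<close>.
\<close>

section \<open>Cubes\<close>

lemma finite_cube [simp]: "finite I \<Longrightarrow> finite (cube I)"
  unfolding cube_def by (rule finite_PiE) auto

lemma cube_eqI: "x \<in> cube I \<Longrightarrow> y \<in> cube I \<Longrightarrow> (\<And>i. i \<in> I \<Longrightarrow> x i = y i) \<Longrightarrow> x = y"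
  unfolding cube_def by (rule PiE_ext)

lemma cube_01: "x \<in> cube I \<Longrightarrow> i \<in> I \<Longrightarrow> x i = 0 \<or> x i = 1"
  unfolding cube_def by auto

lemma cube_undefined: "x \<in> cube I \<Longrightarrow> i \<notin> I \<Longrightarrow> x i = undefined"
  unfolding cube_def by auto

lemma cubeI: "(\<And>i. i \<in> I \<Longrightarrow> x i = 0 \<or> x i = 1) \<Longrightarrow> (\<And>i. i \<notin> I \<Longrightarrow> x i = undefined) \<Longrightarrow> x \<in> cube I"
  unfolding cube_def by (auto simp: PiE_def extensional_def)

lemma sup_cube:
  assumes "x \<in> cube I" "y \<in> cube I"
  shows "sup x y \<in> cube I"
proof (rule cubeI)
  show "sup x y i = 0 \<or> sup x y i = 1" if "i \<in> I" for i
    using cube_01[OF assms(1) that] cube_01[OF assms(2) that] by (auto simp: sup_fun_def sup_real_def)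
qed (use assms in \<open>auto simp: sup_fun_def cube_undefined\<close>)

lemma inf_cube:
  assumes "x \<in> cube I" "y \<in> cube I"
  shows "inf x y \<in> cube I"
proof (rule cubeI)
  show "inf x y i = 0 \<or> inf x y i = 1" if "i \<in> I" for i
    using cube_01[OF assms(1) that] cube_01[OF assms(2) that] by (auto simp: inf_fun_def inf_real_def)
qed (use assms in \<open>auto simp: inf_fun_def cube_undefined\<close>)

lemma restrict_cube: "(\<And>i. i \<in> I \<Longrightarrow> x i = 0 \<or> x i = 1) \<Longrightarrow> (\<lambda>i\<in>I. x i) \<in> cube I"
  by (rule cubeI) auto

lemma case_sum_cube: "x \<in> cube A \<Longrightarrow> z \<in> cube B \<Longrightarrow> case_sum x z \<in> cube (A <+> B)"
  by (rule cubeI) (auto split: sum.splits dest: cube_01 cube_undefined)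

section \<open>Closure properties of quadratic submodular functions\<close>

lemma F2_mlpolyE:
  assumes "f \<in> F2 I"
  obtains p where "\<forall>x\<in>cube I. f x = mlpoly I p x"
    "\<forall>S\<subseteq>I. p S \<noteq> 0 \<longrightarrow> card S \<le> 2"
  using assms unfolding F2_def order_at_most_def mem_Collect_eq
  by (elim conjE exE) (rule that)

lemma F2_add:
  assumes "f \<in> F2 I" "g \<in> F2 I"
  shows "(\<lambda>w. f w + g w) \<in> F2 I"
proof -
  obtain p where p: "\<forall>x\<in>cube I. f x = mlpoly I p x"
    "\<forall>S\<subseteq>I. p S \<noteq> 0 \<longrightarrow> card S \<le> 2"
    by (rule F2_mlpolyE[OF assms(1)]) (rule that)
  obtain q where q: "\<forall>x\<in>cube I. g x = mlpoly I q x"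
    "\<forall>S\<subseteq>I. q S \<noteq> 0 \<longrightarrow> card S \<le> 2"
    by (rule F2_mlpolyE[OF assms(2)]) (rule that)
  have "order_at_most I 2 (\<lambda>w. f w + g w)"
    unfolding order_at_most_def
  proof (intro exI[of _ "\<lambda>S. p S + q S"] conjI ballI allI impI)
    show "f x + g x = mlpoly I (\<lambda>S. p S + q S) x" if "x \<in> cube I" for x
      using bspec[OF p(1) that] bspec[OF q(1) that] by (simp add: mlpoly_def distrib_right sum.distrib)
    show "card S \<le> 2" if "S \<subseteq> I" "p S + q S \<noteq> 0" for S
      using p(2) q(2) that by (cases "p S = 0") auto
  qed
  moreover have "submodular I (\<lambda>w. f w + g w)"
    unfolding submodular_def
  proof (intro ballI)
    fix x y assume "x \<in> cube I" "y \<in> cube I"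
    then have "f (sup x y) + f (inf x y) \<le> f x + f y" "g (sup x y) + g (inf x y) \<le> g x + g y"
      using assms by (auto simp: F2_def submodular_def)
    then show "f (sup x y) + g (sup x y) + (f (inf x y) + g (inf x y)) \<le> f x + g x + (f y + g y)"
      by linarith
  qed
  ultimately show ?thesis unfolding F2_def by simp
qed

text \<open>The cases of \<open>T\<close> empty, a singleton and a pair supply the degree bounds for
  the constant, linear and bilinear terms of \<open>H\<close>.\<close>

lemma order_at_most_monomial:
  assumes "finite I" "T \<subseteq> I" "card T \<le> d"
  shows "order_at_most I d (\<lambda>w. a * (\<Prod>i\<in>T. w i))"
  unfolding order_at_most_def
proof (intro exI[of _ "\<lambda>S. if S = T then a else 0"] conjI ballI allI impI)
  fix x :: "'a \<Rightarrow> real"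
  have "mlpoly I (\<lambda>S. if S = T then a else 0) x
      = (\<Sum>S\<in>Pow I. if S = T then a * (\<Prod>i\<in>S. x i) else 0)"
    unfolding mlpoly_def by (intro sum.cong) auto
  then show "a * (\<Prod>i\<in>T. x i) = mlpoly I (\<lambda>S. if S = T then a else 0) x"
    using assms by simp
  show "card S \<le> d" if "(if S = T then a else 0) \<noteq> 0" for S
    using that assms(3) by (simp split: if_splits)
qed

lemma F2_const: "finite I \<Longrightarrow> (\<lambda>w. a) \<in> F2 I"
  using order_at_most_monomial[of I "{}" 2 a] by (simp add: F2_def submodular_def)

lemma F2_sum:
  assumes "finite I" "\<And>s. s \<in> A \<Longrightarrow> g s \<in> F2 I"
  shows "(\<lambda>w. \<Sum>s\<in>A. g s w) \<in> F2 I"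
  using assms(2)
  \<comment> \<open>For infinite \<open>A\<close> the sum is 0 by convention, hence a constant
    function.\<close>
  by (induction A rule: infinite_finite_induct) (auto intro: F2_const F2_add assms(1))

text \<open>The maximum and minimum of two numbers add up to their sum, so a linear term satisfies
  the submodular inequality with equality, whatever the sign of \<open>a\<close>.\<close>

lemma F2_linear:
  assumes "finite I" "i \<in> I"
  shows "(\<lambda>w. a * w i) \<in> F2 I"
proof -
  have *: "a * max u v + a * min u v = a * u + a * v" for u v :: real
    by (simp add: max_def min_def)
  show ?thesis
    using order_at_most_monomial[of I "{i}" 2 a] assms
    by (simp add: F2_def submodular_def sup_max inf_min *)
qed

text \<open>The product of two 0/1 variables is supermodular, and a non-positive factor reverses the
  inequality. It is checked on all values of the two variables at \<open>x\<close> and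
  \<open>y\<close>.\<close>

lemma F2_bilinear:
  assumes "finite I" "i \<in> I" "j \<in> I" "i \<noteq> j" "a \<le> 0"
  shows "(\<lambda>w. a * w i * w j) \<in> F2 I"
proof -
  have "submodular I (\<lambda>w. a * w i * w j)"
    unfolding submodular_def
  proof (intro ballI)
    fix x y assume "x \<in> cube I" "y \<in> cube I"
    then have "x i = 0 \<or> x i = 1" "x j = 0 \<or> x j = 1" "y i = 0 \<or> y i = 1" "y j = 0 \<or> y j = 1"
      using assms cube_01 by metis+
    then show "a * x i * x j + a * y i * y j
        \<ge> a * sup x y i * sup x y j + a * inf x y i * inf x y j"
      using \<open>a \<le> 0\<close> by (auto simp: sup_fun_def inf_fun_def sup_real_def inf_real_def)
  qed
  then show ?thesis
    using order_at_most_monomial[of I "{i, j}" 2 a] assms by (simp add: F2_def mult.assoc)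
qed

text \<open>Variables may be identified because \<open>w\<^sup>2 = w\<close> on the cube, which turns the image of the
  monomial \<open>S\<close> into the monomial \<open>\<sigma> ` S\<close>, of no larger degree.\<close>

lemma F2_substitute:
  assumes "finite I" "finite J" "\<sigma> \<in> I \<rightarrow> J" "g \<in> F2 I"
  shows "(\<lambda>w. g (\<lambda>i\<in>I. w (\<sigma> i))) \<in> F2 J"
proof -
  let ?r = "\<lambda>w. (\<lambda>i\<in>I. w (\<sigma> i))"
  have r: "?r w \<in> cube I" if "w \<in> cube J" for w
    using assms(3) that by (intro restrict_cube) (auto dest: cube_01)
  obtain p where p: "\<forall>x\<in>cube I. g x = mlpoly I p x"
    "\<forall>S\<subseteq>I. p S \<noteq> 0 \<longrightarrow> card S \<le> 2"
    by (rule F2_mlpolyE[OF assms(4)]) (rule that)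
  \<comment> \<open>Monomials with the same image under \<open>\<sigma>\<close> merge, so their
    coefficients add up.\<close>
  let ?q = "\<lambda>T. \<Sum>S | S \<in> Pow I \<and> \<sigma> ` S = T. p S"
  have "order_at_most J 2 (\<lambda>w. g (?r w))"
    unfolding order_at_most_def
  proof (intro exI[of _ ?q] conjI ballI allI impI)
    fix w assume w: "w \<in> cube J"
    have prod: "(\<Prod>i\<in>S. ?r w i) = (\<Prod>j\<in>\<sigma> ` S. w j)" if "S \<subseteq> I" for S
    proof -
      have fin: "finite S" using that assms(1) by (rule finite_subset)
      have 01: "w (\<sigma> i) = 0 \<or> w (\<sigma> i) = 1" if "i \<in> S" for i
        using that \<open>S \<subseteq> I\<close> assms(3) w by (intro cube_01[of w J]) auto
      have "(\<Prod>i\<in>S. ?r w i) = (\<Prod>i\<in>S. w (\<sigma> i))"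
        using that by (intro prod.cong) auto
      also have "\<dots> = (\<Prod>j\<in>\<sigma> ` S. w j)"
      \<comment> \<open>A product of 0/1 values is 0 as soon as one factor is, and 1 otherwise;
        factors repeated because \<open>\<sigma>\<close> is not injective on \<open>S\<close>
        therefore do no harm.\<close>
      proof (cases "\<exists>i\<in>S. w (\<sigma> i) = 0")
        case True
        then have "(\<Prod>i\<in>S. w (\<sigma> i)) = 0" "(\<Prod>j\<in>\<sigma> ` S. w j) = 0"
          using fin by (auto intro!: prod_zero)
        then show ?thesis by simp
      next
        case False
        then have "(\<Prod>i\<in>S. w (\<sigma> i)) = 1" "(\<Prod>j\<in>\<sigma> ` S. w j) = 1"
          using 01 by (auto intro!: prod.neutral)
        then show ?thesis by simp
      qed
      finally show ?thesis .
    qed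
    have "g (?r w) = (\<Sum>S\<in>Pow I. p S * (\<Prod>j\<in>\<sigma> ` S. w j))"
      unfolding bspec[OF p(1) r[OF w]] mlpoly_def by (intro sum.cong) (use prod in auto)
    also have "\<dots> = (\<Sum>T\<in>Pow J. \<Sum>S | S \<in> Pow I \<and> \<sigma> ` S = T. p S * (\<Prod>j\<in>\<sigma> ` S. w j))"
      by (rule sum.group[symmetric]) (use assms in auto)
    also have "\<dots> = mlpoly J ?q w"
      unfolding mlpoly_def sum_distrib_right by (intro sum.cong) auto
    finally show "g (?r w) = mlpoly J ?q w" .
  next
    fix T assume "?q T \<noteq> 0"
    then obtain S where S: "S \<subseteq> I" "\<sigma> ` S = T" "p S \<noteq> 0"
      by (metis (mono_tags, lifting) PowD mem_Collect_eq sum.not_neutral_contains_not_neutral)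
    have "finite S" using S(1) assms(1) by (rule finite_subset)
    then show "card T \<le> 2"
      using p(2)[rule_format, OF S(1,3)] card_image_le[of S \<sigma>] S(2) by auto
  qed
  moreover have "submodular J (\<lambda>w. g (?r w))"
    unfolding submodular_def
  proof (intro ballI)
    fix x y assume xy: "x \<in> cube J" "y \<in> cube J"
    have "?r (sup x y) = sup (?r x) (?r y)" "?r (inf x y) = inf (?r x) (?r y)"
      by (auto simp: fun_eq_iff sup_fun_def inf_fun_def)
    moreover have "submodular I g" using assms(4) by (simp add: F2_def)
    ultimately show "g (?r (sup x y)) + g (?r (inf x y)) \<le> g (?r x) + g (?r y)"
      using r[OF xy(1)] r[OF xy(2)] by (simp add: submodular_def)
  qed
  ultimately show ?thesis unfolding F2_def by simp
qed

section \<open>Coefficients of quadratic submodular functions\<close>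

text \<open>At the indicator vector of \<open>S\<close>, the monomial of \<open>T\<close> is 1 if
  \<open>T\<close> is contained in \<open>S\<close> and 0 otherwise. Such values make single
  coefficients accessible.\<close>

lemma mlpoly_indicator:
  assumes "finite I" "S \<subseteq> I"
  shows "mlpoly I p (\<lambda>i\<in>I. if i \<in> S then 1 else 0) = (\<Sum>T\<in>Pow S. p T)"
proof -
  have "p T * (\<Prod>i\<in>T. (\<lambda>i\<in>I. if i \<in> S then 1 else 0) i) = (if T \<in> Pow S then p T else 0)"
    if "T \<in> Pow I" for T
  proof -
    have "finite T" using that assms(1) finite_subset by auto
    have "(\<Prod>i\<in>T. (\<lambda>i\<in>I. if i \<in> S then 1 else (0::real)) i) = (\<Prod>i\<in>T. if i \<in> S then 1 else 0)"
      using that by (intro prod.cong) auto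
    also have "\<dots> = (if T \<subseteq> S then 1 else 0)"
      using \<open>finite T\<close> by (auto intro!: prod.neutral)
    finally show ?thesis by simp
  qed
  then have "mlpoly I p (\<lambda>i\<in>I. if i \<in> S then 1 else 0)
      = (\<Sum>T\<in>Pow I. if T \<in> Pow S then p T else 0)"
    unfolding mlpoly_def by (intro sum.cong) auto
  also have "\<dots> = (\<Sum>T\<in>Pow S. p T)"
    using assms by (intro sum.mono_neutral_cong_right) auto
  finally show ?thesis .
qed

text \<open>Evaluation at indicator vectors expresses \<open>p {u, v}\<close> as the value at
  \<open>{u, v}\<close> plus the value at \<open>{}\<close> minus the values at \<open>{u}\<close>
  and \<open>{v}\<close>; submodularity for the two singletons bounds this by 0.\<close>

lemma submodular_pair_coeff_nonpos:
  assumes "finite I" "submodular I g" and g: "\<forall>x\<in>cube I. g x = mlpoly I p x"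
    and uv: "u \<in> I" "v \<in> I" "u \<noteq> v"
  shows "p {u, v} \<le> 0"
proof -
  let ?e = "\<lambda>S. (\<lambda>i\<in>I. if i \<in> S then 1 else (0::real))"
  have e: "?e S \<in> cube I" for S by (rule restrict_cube) auto
  have val: "g (?e S) = (\<Sum>T\<in>Pow S. p T)" if "S \<subseteq> I" for S
    using bspec[OF g e] mlpoly_indicator[OF assms(1) that] by simp
  have "sup (?e {u}) (?e {v}) = ?e {u, v}" "inf (?e {u}) (?e {v}) = ?e {}"
    using uv by (auto simp: fun_eq_iff sup_fun_def inf_fun_def sup_real_def inf_real_def)
  then have "g (?e {u, v}) + g (?e {}) \<le> g (?e {u}) + g (?e {v})"
    using assms(2) e[of "{u}"] e[of "{v}"] unfolding submodular_def by metis
  then have "sum p (Pow {u, v}) + sum p (Pow {}) \<le> sum p (Pow {u}) + sum p (Pow {v})"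
    using uv by (simp only: val insert_subset empty_subsetI simp_thms)
  moreover have "Pow {u, v} = {{}, {u}, {v}, {u, v}}" "Pow {u} = {{}, {u}}" "Pow {v} = {{}, {v}}"
    by (auto simp: Pow_insert)
  ultimately show ?thesis
    using uv by (simp add: doubleton_eq_iff)
qed

section \<open>Coefficient vectors of \<open>H\<close> and quadratic submodular functions on the
  joint cube\<close>

text \<open>This is constraint (ii) of the linear program, isolated because it is the sign condition
  that links coefficients with submodularity.\<close>

definition coeffs_nonpos :: "nat \<Rightarrow> nat \<Rightarrow> coeffs \<Rightarrow> bool"
  where "coeffs_nonpos k N c \<longleftrightarrow>
    (\<forall>i j. 1 \<le> i \<and> i < j \<and> j \<le> k \<longrightarrow> cf_alpha c i j \<le> 0) \<and>
    (\<forall>i\<in>{1..k}. \<forall>l\<in>{1..N}. cf_beta c i l \<le> 0) \<and>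
    (\<forall>l l'. 1 \<le> l \<and> l < l' \<and> l' \<le> N \<longrightarrow> cf_gamma c l l' \<le> 0)"

text \<open>\<open>H\<close> is a sum of constant, linear and bilinear terms, the latter in two
  distinct variables; under the sign condition each of them lies in \<open>F2\<close>.\<close>

lemma H_in_F2_joint:
  assumes "coeffs_nonpos k N c"
  shows "H k N c \<in> F2_joint k N"
  unfolding F2_joint_def H_def mem_Collect_eq comp_def
  by (intro F2_add F2_sum F2_const F2_linear F2_bilinear)
    (use assms in \<open>auto simp: coeffs_nonpos_def\<close>)

text \<open>The six families on the right index the six groups of terms of \<open>H\<close>. A pair
  within one block is listed once, with the smaller index first.\<close>

lemma card_le_2_subsets_Plus:
  "{S. S \<subseteq> {1..k} <+> {1..N} \<and> card S \<le> 2}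
    = {{}} \<union> (\<lambda>i. {Inl i}) ` {1..k} \<union> (\<lambda>l. {Inr l}) ` {1..N}
      \<union> (\<lambda>(i, j). {Inl i, Inl j}) ` (SIGMA i:{1..k}. {i+1..k})
      \<union> (\<lambda>(i, l). {Inl i, Inr l}) ` ({1..k} \<times> {1..N})
      \<union> (\<lambda>(l, l'). {Inr l, Inr l'}) ` (SIGMA l:{1..N}. {l+1..N})"
  (is "?L = ?R")
  for k N :: nat
proof (intro equalityI subsetI)
  fix S assume "S \<in> ?L"
  then have S: "S \<subseteq> {1..k} <+> {1..N}" "card S = 0 \<or> card S = 1 \<or> card S = 2" by auto
  have "finite S" using S(1) by (rule finite_subset) auto
  consider "S = {}" | u where "S = {u}" | u v where "S = {u, v}" "u \<noteq> v"
    using S(2) \<open>finite S\<close> by (auto simp: card_1_singleton_iff card_2_iff)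
  then show "S \<in> ?R"
  proof cases
    case (2 u)
    then show ?thesis using S(1) by (cases u) auto
  next
    case (3 u v)
    then consider (LL) i j where "i < j" "S = {Inl i, Inl j}" | (LR) i l where "S = {Inl i, Inr l}"
      | (RR) l l' where "l < l'" "S = {Inr l, Inr l'}"
      by (cases u; cases v) (metis insert_commute linorder_neqE_nat)+
    then show ?thesis
    proof cases
      case LL
      then have "S \<in> (\<lambda>(i, j). {Inl i, Inl j}) ` (SIGMA i:{1..k}. {i+1..k})"
        using S(1) by (intro image_eqI[of _ _ "(i, j)"]) auto
      then show ?thesis by (rule UnI1[OF UnI1[OF UnI2]])
    next
      case LR
      then have "S \<in> (\<lambda>(i, l). {Inl i, Inr l}) ` ({1..k} \<times> {1..N})"
        using S(1) by (intro image_eqI[of _ _ "(i, l)"]) auto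
      then show ?thesis by (rule UnI1[OF UnI2])
    next
      case RR
      then have "S \<in> (\<lambda>(l, l'). {Inr l, Inr l'}) ` (SIGMA l:{1..N}. {l+1..N})"
        using S(1) by (intro image_eqI[of _ _ "(l, l')"]) auto
      then show ?thesis by (rule UnI2)
    qed
  qed auto
qed (auto simp: card_insert_if)

text \<open>The six families are pairwise disjoint and each is indexed injectively, the strict order
  of the indices fixing the order of a pair within one block. Hence no term is counted
  twice.\<close>

lemma sum_card_le_2_subsets_Plus:
  fixes g :: "(nat + nat) set \<Rightarrow> real"
  shows "(\<Sum>S | S \<subseteq> {1..k} <+> {1..N} \<and> card S \<le> 2. g S)
    = g {} + (\<Sum>i=1..k. g {Inl i}) + (\<Sum>l=1..N. g {Inr l})
      + (\<Sum>i=1..k. \<Sum>j=i+1..k. g {Inl i, Inl j})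
      + (\<Sum>i=1..k. \<Sum>l=1..N. g {Inl i, Inr l})
      + (\<Sum>l=1..N. \<Sum>l'=l+1..N. g {Inr l, Inr l'})"
proof -
  let ?A = "(\<lambda>i. {Inl i :: nat + nat}) ` {1..k}"
  let ?B = "(\<lambda>l. {Inr l :: nat + nat}) ` {1..N}"
  let ?C = "(\<lambda>(i, j). {Inl i, Inl j :: nat + nat}) ` (SIGMA i:{1..k}. {i+1..k})"
  let ?D = "(\<lambda>(i, l). {Inl i, Inr l :: nat + nat}) ` ({1..k} \<times> {1..N})"
  let ?E = "(\<lambda>(l, l'). {Inr l, Inr l' :: nat + nat}) ` (SIGMA l:{1..N}. {l+1..N})"
  have "sum g ({{}} \<union> ?A \<union> ?B \<union> ?C \<union> ?D \<union> ?E)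
      = sum g {{}} + sum g ?A + sum g ?B + sum g ?C + sum g ?D + sum g ?E"
    by (subst sum.union_disjoint, (force simp: doubleton_eq_iff)+)+
  moreover have "sum g ?A = (\<Sum>i=1..k. g {Inl i})" "sum g ?B = (\<Sum>l=1..N. g {Inr l})"
    by (subst sum.reindex; auto simp: inj_on_def)+
  moreover have "sum g ?C = (\<Sum>i=1..k. \<Sum>j=i+1..k. g {Inl i, Inl j})"
    by (subst sum.reindex) (auto simp: inj_on_def doubleton_eq_iff sum.Sigma case_prod_unfold)
  moreover have "sum g ?D = (\<Sum>i=1..k. \<Sum>l=1..N. g {Inl i, Inr l})"
    by (subst sum.reindex) (auto simp: inj_on_def doubleton_eq_iff sum.Sigma case_prod_unfold)
  moreover have "sum g ?E = (\<Sum>l=1..N. \<Sum>l'=l+1..N. g {Inr l, Inr l'})"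
    by (subst sum.reindex) (auto simp: inj_on_def doubleton_eq_iff sum.Sigma case_prod_unfold)
  ultimately show ?thesis
    unfolding card_le_2_subsets_Plus by simp
qed

text \<open>Converse of \<open>H_in_F2_joint\<close>: the coefficients of the representing
  polynomial serve as those of \<open>H\<close>, and submodularity gives the signs.\<close>

lemma F2_Plus_eq_H:
  assumes "g \<in> F2 ({1..k} <+> {1..N})"
  obtains c where "coeffs_nonpos k N c"
    "\<And>w. w \<in> cube ({1..k} <+> {1..N}) \<Longrightarrow> g w = H k N c (w \<circ> Inl) (w \<circ> Inr)"
proof -
  let ?I = "{1..k} <+> {1..N}"
  obtain p where p: "\<forall>x\<in>cube ?I. g x = mlpoly ?I p x"
    "\<forall>S\<subseteq>?I. p S \<noteq> 0 \<longrightarrow> card S \<le> 2"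
    by (rule F2_mlpolyE[OF assms]) (rule that)
  have neg: "p {u, v} \<le> 0" if "u \<in> ?I" "v \<in> ?I" "u \<noteq> v" for u v
    using assms p(1) that by (intro submodular_pair_coeff_nonpos[of ?I g]) (auto simp: F2_def)
  define c where "c = \<lparr>cf_0 = p {}, cf_a = (\<lambda>i. p {Inl i}), cf_b = (\<lambda>l. p {Inr l}),
    cf_alpha = (\<lambda>i j. p {Inl i, Inl j}), cf_beta = (\<lambda>i l. p {Inl i, Inr l}),
    cf_gamma = (\<lambda>l l'. p {Inr l, Inr l'})\<rparr>"
  have "coeffs_nonpos k N c"
    unfolding coeffs_nonpos_def c_def by (auto intro!: neg)
  moreover have "g w = H k N c (w \<circ> Inl) (w \<circ> Inr)" if "w \<in> cube ?I" for w
  proof -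
    \<comment> \<open>Sets with more than two elements have coefficient 0 and drop out.\<close>
    have "g w = (\<Sum>S | S \<subseteq> ?I \<and> card S \<le> 2. p S * (\<Prod>i\<in>S. w i))"
      unfolding bspec[OF p(1) that] mlpoly_def using p(2) by (intro sum.mono_neutral_right) auto
    also have "\<dots> = H k N c (w \<circ> Inl) (w \<circ> Inr)"
      unfolding sum_card_le_2_subsets_Plus H_def c_def by (simp add: mult.assoc)
    finally show ?thesis .
  qed
  ultimately show ?thesis using that by blast
qed

section \<open>Monotone minimisers\<close>

text \<open>Joins and meets of joint vectors are formed separately in the two blocks, so
  submodularity on the joint cube can be applied to pairs.\<close>

lemma F2_joint_submodular:
  assumes "h \<in> F2_joint k n"
    and "x \<in> cube {1..k}" "y \<in> cube {1..k}" "z \<in> cube {1..n}" "z' \<in> cube {1..n}"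
  shows "h (sup x y) (sup z z') + h (inf x y) (inf z z') \<le> h x z + h y z'"
proof -
  have "sup (case_sum x z) (case_sum y z') = case_sum (sup x y) (sup z z')"
    "inf (case_sum x z) (case_sum y z') = case_sum (inf x y) (inf z z')"
    by (auto simp: fun_eq_iff sup_fun_def inf_fun_def split: sum.split)
  moreover have "case_sum u v \<circ> Inl = u" "case_sum u v \<circ> Inr = v" for u v :: "nat \<Rightarrow> real"
    by auto
  ultimately show ?thesis
    using assms case_sum_cube[OF assms(2,4)] case_sum_cube[OF assms(3,5)]
    unfolding F2_joint_def F2_def submodular_def by fastforce
qed

text \<open>For \<open>x \<le> y\<close>, submodularity at the pairs of \<open>x\<close> with
  \<open>\<zeta> x\<close> and of \<open>y\<close> with \<open>\<zeta> y\<close> shows that the meet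
  of \<open>\<zeta> x\<close> and \<open>\<zeta> y\<close> also minimises \<open>h x\<close>. The
  choice of \<open>\<zeta> x\<close> then forces this meet to be \<open>\<zeta> x\<close>.\<close>

lemma F2_joint_monotone_minimiser:
  assumes h: "h \<in> F2_joint k n"
  obtains \<zeta> where "mono_on (cube {1..k}) \<zeta>"
    "\<And>x. x \<in> cube {1..k} \<Longrightarrow> \<zeta> x \<in> cube {1..n}"
    "\<And>x z. x \<in> cube {1..k} \<Longrightarrow> z \<in> cube {1..n} \<Longrightarrow> h x (\<zeta> x) \<le> h x z"
proof -
  define M where "M x = {z \<in> cube {1..n}. \<forall>z'\<in>cube {1..n}. h x z \<le> h x z'}" for x
  have ne: "M x \<noteq> {}" for x
  proof -
    have "(\<lambda>l\<in>{1..n}. 0) \<in> cube {1..n}" by (rule restrict_cube) auto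
    then have "cube {1..n} \<noteq> {}" by blast
    then show ?thesis
      using ex_min_if_finite[of "h x ` cube {1..n}"] by (force simp: M_def not_less)
  qed
  \<comment> \<open>A minimiser with the smallest coordinate sum is the least one, as \<open>M x\<close> is closed under \<open>inf\<close>.\<close>
  let ?s = "\<lambda>z :: nat \<Rightarrow> real. \<Sum>l\<in>{1..n}. z l"
  define \<zeta> where "\<zeta> x = arg_min_on ?s (M x)" for x
  have fin: "finite (M x)" for x
    unfolding M_def by simp
  have \<zeta>: "\<zeta> x \<in> M x" "\<And>z. z \<in> M x \<Longrightarrow> ?s (\<zeta> x) \<le> ?s z" for x
    unfolding \<zeta>_def using arg_min_if_finite(1)[OF fin ne] arg_min_least[OF fin ne] by auto
  have \<zeta>_cube: "\<zeta> x \<in> cube {1..n}" for x using \<zeta>(1)[of x] by (simp add: M_def)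
  have "\<zeta> x \<le> \<zeta> y" if "x \<in> cube {1..k}" "y \<in> cube {1..k}" "x \<le> y" for x y
  proof -
    \<comment> \<open>As \<open>x \<le> y\<close>, the join of \<open>x\<close> and \<open>y\<close>
      is \<open>y\<close> and their meet is \<open>x\<close>, so only the auxiliary vectors get
      mixed.\<close>
    have "h y (sup (\<zeta> x) (\<zeta> y)) + h x (inf (\<zeta> x) (\<zeta> y)) \<le> h x (\<zeta> x) + h y (\<zeta> y)"
      using F2_joint_submodular[OF h that(1,2) \<zeta>_cube[of x] \<zeta>_cube[of y]] that(3)
      by (simp add: sup_absorb2 inf_absorb1)
    \<comment> \<open>The join is a competitor of the minimiser \<open>\<zeta> y\<close>; cancelling
      its cost leaves the comparison at \<open>x\<close>.\<close>
    moreover have "h y (\<zeta> y) \<le> h y (sup (\<zeta> x) (\<zeta> y))"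
      using \<zeta>(1)[of y] sup_cube[OF \<zeta>_cube \<zeta>_cube] by (simp add: M_def)
    ultimately have "h x (inf (\<zeta> x) (\<zeta> y)) \<le> h x (\<zeta> x)" by simp
    then have "inf (\<zeta> x) (\<zeta> y) \<in> M x"
      using \<zeta>(1)[of x] inf_cube[OF \<zeta>_cube \<zeta>_cube] unfolding M_def by force
    then have le: "?s (\<zeta> x) \<le> ?s (inf (\<zeta> x) (\<zeta> y))" by (rule \<zeta>(2))
    \<comment> \<open>The meet is below \<open>\<zeta> x\<close> in every coordinate, so equal
      coordinate sums exclude a strict inequality.\<close>
    have "inf (\<zeta> x) (\<zeta> y) l = \<zeta> x l" if "l \<in> {1..n}" for l
    proof (rule sum_mono_inv[OF _ _ that])
      show "?s (inf (\<zeta> x) (\<zeta> y)) = ?s (\<zeta> x)"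
        by (rule antisym[OF _ le]) (auto intro!: sum_mono simp: inf_fun_def)
    qed (auto simp: inf_fun_def)
    then have "inf (\<zeta> x) (\<zeta> y) = \<zeta> x"
      by (intro cube_eqI[OF inf_cube[OF \<zeta>_cube \<zeta>_cube] \<zeta>_cube])
    then show ?thesis by (simp add: inf.order_iff)
  qed
  then have "mono_on (cube {1..k}) \<zeta>" by (simp add: mono_on_def)
  then show ?thesis using that \<zeta>_cube \<zeta>(1) by (auto simp: M_def)
qed

section \<open>The linear program\<close>

lemma mvec_cube:
  assumes "m ` {1..N} \<subseteq> monotonic_bool k" "x \<in> cube {1..k}"
  shows "mvec N m x \<in> cube {1..N}"
  unfolding mvec_def
proof (rule restrict_cube)
  fix l assume "l \<in> {1..N}"
  then have "m l \<in> monotonic_bool k" using assms(1) by blast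
  then show "m l x = 0 \<or> m l x = 1"
    using assms(2) by (auto simp: monotonic_bool_def dest: PiE_mem)
qed

text \<open>The vector \<open>c\<close> arises from \<open>h\<close> by reading the auxiliary
  variable \<open>j\<close> off \<open>z (\<tau> j)\<close>. No value drops below
  \<open>f x\<close>, since the substituted vector is a point of the auxiliary cube of
  \<open>h\<close>; at \<open>mvec N m x\<close> it is the minimiser \<open>\<zeta> x\<close>, so
  \<open>f x\<close> is attained.\<close>

lemma Fk2_representation_monotonic:
  assumes m: "m ` {1..N} = monotonic_bool k" and f: "f \<in> Fk2 k"
  obtains c where "coeffs_nonpos k N c"
    "\<And>x. x \<in> cube {1..k} \<Longrightarrow> H k N c x (mvec N m x) = f x"
    "\<And>x z. x \<in> cube {1..k} \<Longrightarrow> z \<in> cube {1..N} \<Longrightarrow> f x \<le> H k N c x z"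
proof -
  obtain n h where h: "h \<in> F2_joint k n" "\<And>x. x \<in> cube {1..k} \<Longrightarrow> f x = Min (h x ` cube {1..n})"
    using f unfolding Fk2_def by blast
  obtain \<zeta> where \<zeta>: "mono_on (cube {1..k}) \<zeta>" "\<And>x. x \<in> cube {1..k} \<Longrightarrow> \<zeta> x \<in> cube {1..n}"
    "\<And>x z. x \<in> cube {1..k} \<Longrightarrow> z \<in> cube {1..n} \<Longrightarrow> h x (\<zeta> x) \<le> h x z"
    using F2_joint_monotone_minimiser[OF h(1)] by blast
  have fx: "f x = h x (\<zeta> x)" if "x \<in> cube {1..k}" for x
    unfolding h(2)[OF that] using \<zeta>(2,3) that by (intro Min_eqI) auto
  have "\<exists>l\<in>{1..N}. \<forall>x\<in>cube {1..k}. m l x = \<zeta> x j" if "j \<in> {1..n}" for j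
  proof -
    \<comment> \<open>Restriction to the cube makes the coordinate function extensional, as members
      of \<open>monotonic_bool\<close> are, so that it can be equal to some
      \<open>m l\<close>.\<close>
    let ?\<phi> = "\<lambda>x\<in>cube {1..k}. \<zeta> x j"
    have "?\<phi> x = 0 \<or> ?\<phi> x = 1" if "x \<in> cube {1..k}" for x
      using cube_01[OF \<zeta>(2)[OF that] \<open>j \<in> {1..n}\<close>] that by simp
    moreover have "mono_on (cube {1..k}) ?\<phi>"
      using \<zeta>(1) by (auto simp: mono_on_def le_fun_def)
    ultimately have "?\<phi> \<in> monotonic_bool k"
      unfolding monotonic_bool_def by (auto intro!: PiE_I)
    then obtain l where "l \<in> {1..N}" "m l = ?\<phi>" using m by (metis imageE)
    then show ?thesis by (intro bexI[of _ l]) auto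
  qed
  \<comment> \<open>\<open>\<tau>\<close> may be non-injective: auxiliary variables whose coordinate
    functions coincide can share an index.\<close>
  then obtain \<tau> where \<tau>: "\<And>j. j \<in> {1..n} \<Longrightarrow> \<tau> j \<in> {1..N}"
    "\<And>j x. j \<in> {1..n} \<Longrightarrow> x \<in> cube {1..k} \<Longrightarrow> m (\<tau> j) x = \<zeta> x j"
    by metis
  let ?I = "{1..k} <+> {1..n}" and ?J = "{1..k} <+> {1..N}"
  let ?g = "\<lambda>w. h (w \<circ> Inl) (w \<circ> Inr)"
  \<comment> \<open>The original variables stay fixed and only auxiliary ones are renamed.\<close>
  define \<sigma> where "\<sigma> = map_sum (id :: nat \<Rightarrow> nat) \<tau>"
  have "(\<lambda>w. ?g (\<lambda>i\<in>?I. w (\<sigma> i))) \<in> F2 ?J"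
  proof (rule F2_substitute)
    show "?g \<in> F2 ?I" using h(1) by (simp only: F2_joint_def mem_Collect_eq)
  qed (use \<tau>(1) in \<open>auto simp: \<sigma>_def\<close>)
  then obtain c where c: "coeffs_nonpos k N c"
    "\<And>w. w \<in> cube ?J \<Longrightarrow> ?g (\<lambda>i\<in>?I. w (\<sigma> i)) = H k N c (w \<circ> Inl) (w \<circ> Inr)"
    using F2_Plus_eq_H by blast
  have Hc: "H k N c x z = h x (\<lambda>j\<in>{1..n}. z (\<tau> j))"
    if "x \<in> cube {1..k}" "z \<in> cube {1..N}" for x z
  proof -
    have "(\<lambda>i\<in>?I. case_sum x z (\<sigma> i)) \<circ> Inl = x"
    proof
      show "((\<lambda>i\<in>?I. case_sum x z (\<sigma> i)) \<circ> Inl) i = x i" for i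
        using cube_undefined[OF that(1), of i] by (cases "i \<in> {1..k}") (auto simp: \<sigma>_def)
    qed
    moreover have "(\<lambda>i\<in>?I. case_sum x z (\<sigma> i)) \<circ> Inr = (\<lambda>j\<in>{1..n}. z (\<tau> j))"
      by (auto simp: fun_eq_iff \<sigma>_def)
    moreover have "case_sum x z \<circ> Inl = x" "case_sum x z \<circ> Inr = z" by auto
    ultimately show ?thesis using c(2)[OF case_sum_cube[OF that]] by simp
  qed
  have "f x \<le> H k N c x z" if "x \<in> cube {1..k}" "z \<in> cube {1..N}" for x z
    unfolding Hc[OF that] fx[OF that(1)]
    using that \<tau>(1) by (intro \<zeta>(3) restrict_cube) (auto dest!: cube_01)
  moreover have "H k N c x (mvec N m x) = f x"
    if "x \<in> cube {1..k}" for x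
  proof -
    have "mvec N m x \<in> cube {1..N}" using m that by (intro mvec_cube) auto
    moreover
    have "(\<lambda>j\<in>{1..n}. mvec N m x (\<tau> j)) = \<zeta> x"
      using \<tau> that cube_undefined[OF \<zeta>(2)[OF that]] by (auto simp: fun_eq_iff mvec_def)
    ultimately show ?thesis using Hc[OF that] fx[OF that] by simp
  qed
  ultimately show ?thesis using that c(1) by blast
qed

theorem theorem1:
  fixes k N :: nat
    and m :: "nat \<Rightarrow> (nat \<Rightarrow> real) \<Rightarrow> real"
    and f :: "(nat \<Rightarrow> real) \<Rightarrow> real"
  assumes "k \<ge> 1"
    and "N = dedekind k"
    and "bij_betw m {1..N} (monotonic_bool k)"
    and "f \<in> Fk2 k"
  shows "(\<exists>s. lp_feasible k N m f s) \<and>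
    (\<exists>s. lp_optimal k N m f s \<and> lp_objective k s = 0) \<and>
    (\<forall>c t. lp_optimal k N m f (c, t) \<longrightarrow>
      H k N c \<in> F2_joint k N \<and>
      (\<forall>x\<in>cube {1..k}. f x = Min (H k N c x ` cube {1..N})))"
proof -
  have m: "m ` {1..N} = monotonic_bool k"
    using assms(3) by (simp add: bij_betw_def)
  obtain c\<^sub>0 where c\<^sub>0: "coeffs_nonpos k N c\<^sub>0"
    "\<And>x. x \<in> cube {1..k} \<Longrightarrow> H k N c\<^sub>0 x (mvec N m x) = f x"
    "\<And>x z. x \<in> cube {1..k} \<Longrightarrow> z \<in> cube {1..N} \<Longrightarrow> f x \<le> H k N c\<^sub>0 x z"
    using Fk2_representation_monotonic[OF m assms(4)] by blast
  let ?s = "(c\<^sub>0, \<lambda>_. 0)"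
  have feasible: "lp_feasible k N m f ?s"
    using c\<^sub>0 by (auto simp: lp_feasible_def coeffs_nonpos_def)
  have objective: "lp_objective k ?s = 0" by (simp add: lp_objective_def)
  \<comment> \<open>The two lower bounds in (i) are negatives of each other, so \<open>t x\<close>
    is at least an absolute value.\<close>
  have t_nonneg: "0 \<le> t x" if "lp_feasible k N m f (c, t)" "x \<in> cube {1..k}" for c t x
    using that unfolding lp_feasible_def by fastforce
  have "0 \<le> lp_objective k s" if "lp_feasible k N m f s" for s
    using that t_nonneg by (cases s) (auto simp: lp_objective_def intro!: sum_nonneg)
  with feasible objective have optimal: "lp_optimal k N m f ?s"
    by (force simp: is_arg_min_def)
  have "H k N c \<in> F2_joint k N \<and> (\<forall>x\<in>cube {1..k}. f x = Min (H k N c x ` cube {1..N}))"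
    if opt: "lp_optimal k N m f (c, t)" for c t
  proof (intro conjI ballI)
    have feas: "lp_feasible k N m f (c, t)" using opt by (simp add: is_arg_min_def)
    then show "H k N c \<in> F2_joint k N"
      by (intro H_in_F2_joint) (auto simp: lp_feasible_def coeffs_nonpos_def)
    fix x assume x: "x \<in> cube {1..k}"
    have "lp_objective k (c, t) \<le> lp_objective k ?s"
      using opt feasible unfolding is_arg_min_linorder by blast
    \<comment> \<open>A single value is at most the sum of the non-negative values of
      \<open>t\<close>, which optimality keeps at or below 0.\<close>
    moreover have "t x \<le> lp_objective k (c, t)"
      unfolding lp_objective_def prod.case
      by (rule member_le_sum) (use x t_nonneg[OF feas] in auto)
    ultimately have "t x \<le> 0" using objective by simp
    \<comment> \<open>With \<open>t x \<le> 0\<close>, both differences in (i) are at most 0.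
      Together with (iii), \<open>mvec N m x\<close> becomes a minimiser with value
      \<open>f x\<close>.\<close>
    then have "H k N c x (mvec N m x) = f x"
      using feas x by (fastforce simp: lp_feasible_def)
    moreover have "mvec N m x \<in> cube {1..N}"
      using m x by (intro mvec_cube) auto
    moreover have "H k N c x (mvec N m x) \<le> H k N c x z" if "z \<in> cube {1..N}" for z
      using feas x that by (simp add: lp_feasible_def)
    ultimately show "f x = Min (H k N c x ` cube {1..N})"
      by (intro Min_eqI[symmetric]) (auto intro: rev_image_eqI)
  qed
  then show ?thesis using feasible objective optimal by blast
qed

end
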